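(* Let $m\ge 1$ be an integer and let $2m=2^k\,p_1^{e_1}\cdots p_N^{e_N}$ be its prime factorization, with $k\in\mathbb N$, distinct odd primes $p_1,\dots,p_N$ ($N\ge 0$) and exponents $e_j\ge 1$. For a subset $A\subseteq\{1,\dots,N\}$ put $$n_A=2^{k-1}\,p_1^{e_1-1}\cdots p_N^{e_N-1}\prod_{j\in A}p_j .$$ Then, as rational functions in $x$, $$C(2m,x)=\frac{\displaystyle\prod_{A\subseteq\{1,\dots,N\},\ N-|A|\ \text{even}}\hat t(n_A,x)}{\displaystyle\prod_{A\subseteq\{1,\dots,N\},\ N-|A|\ \text{odd}}\hat t(n_A,x)} .$$
   Context: $C(n,x)$ is the minimal polynomial over $\mathbb Q$ of $2\cos(\pi/n)$. For $n\ge 0$, $\hat t(n,x)=2\,T_n(x/2)$, where $T_n$ is the Chebyshev polynomial of the first kind; for $n\ge1$ it is a monic integer polynomial of degree $n$, with $\hat t(n,2\cos\theta)=2\cos(n\theta)$. Empty products equal $1$. *)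

theory Defs
  imports Complex_Main "HOL-Computational_Algebra.Computational_Algebra"
begin

definition is_min_poly :: "'a::field_char_0 \<Rightarrow> rat poly \<Rightarrow> bool" where
  "is_min_poly x p \<longleftrightarrow>
     lead_coeff p = 1 \<and> poly (map_poly of_rat p) x = 0 \<and>
     (\<forall>q. q \<noteq> 0 \<and> poly (map_poly of_rat q) x = 0 \<longrightarrow> degree p \<le> degree q)"

text \<open>Only meaningful for \<open>x\<close> algebraic over the rationals, see \<open>is_min_poly_min_poly\<close> below.\<close>

definition min_poly :: "'a::field_char_0 \<Rightarrow> rat poly" where
  "min_poly x = (THE p. is_min_poly x p)"

definition C_poly :: "nat \<Rightarrow> rat poly" where
  "C_poly n = min_poly (2 * cos (pi / real n) :: real)"

fun chebyshev_T :: "nat \<Rightarrow> rat poly" where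
  "chebyshev_T 0 = 1"
| "chebyshev_T (Suc 0) = [:0, 1:]"
| "chebyshev_T (Suc (Suc n)) = [:0, 2:] * chebyshev_T (Suc n) - chebyshev_T n"

definition t_hat :: "nat \<Rightarrow> rat poly" where
  "t_hat n = smult 2 (pcompose (chebyshev_T n) [:0, 1/2:])"

lemma map_poly_of_rat_add:
  "map_poly of_rat (p + q) = (map_poly of_rat p + map_poly of_rat q :: 'a::field_char_0 poly)"
  by (intro poly_eqI) (simp add: coeff_map_poly of_rat_add)

lemma map_poly_of_rat_diff:
  "map_poly of_rat (p - q) = (map_poly of_rat p - map_poly of_rat q :: 'a::field_char_0 poly)"
  by (intro poly_eqI) (simp add: coeff_map_poly of_rat_diff)

lemma map_poly_of_rat_smult:
  "map_poly of_rat (smult c p) = (smult (of_rat c) (map_poly of_rat p) :: 'a::field_char_0 poly)"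
  by (intro poly_eqI) (simp add: coeff_map_poly of_rat_mult)

lemma is_min_poly_unique:
  assumes "is_min_poly x p" "is_min_poly x q"
  shows "p = q"
proof (rule ccontr)
  assume "p \<noteq> q"
  have deg: "degree p = degree q"
  proof (rule antisym)
    show "degree p \<le> degree q" "degree q \<le> degree p"
      using assms unfolding is_min_poly_def by (metis leading_coeff_0_iff zero_neq_one)+
  qed
  have "poly (map_poly of_rat (p - q)) x = 0"
    using assms by (simp add: is_min_poly_def map_poly_of_rat_diff)
  then have le: "degree p \<le> degree (p - q)"
    using assms(1) \<open>p \<noteq> q\<close> unfolding is_min_poly_def by auto
  have "coeff (p - q) (degree p) = 0"
    using assms deg by (simp add: is_min_poly_def)
  moreover have "degree (p - q) \<le> degree p"
    using deg by (simp add: degree_diff_le)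
  ultimately have "lead_coeff (p - q) = 0"
    using le by (simp add: antisym)
  then show False
    using \<open>p \<noteq> q\<close> by (metis leading_coeff_0_iff right_minus_eq)
qed

lemma is_min_poly_min_poly:
  fixes x :: "'a::field_char_0"
  assumes "q \<noteq> 0" "poly (map_poly of_rat q) x = 0"
  shows "is_min_poly x (min_poly x)"
proof -
  define P where "P = (\<lambda>r::rat poly. r \<noteq> 0 \<and> poly (map_poly of_rat r) x = 0)"
  obtain r where r: "P r" "\<And>s. P s \<Longrightarrow> degree r \<le> degree s"
    using ex_has_least_nat[of P q degree] assms by (auto simp: P_def)
  define p where "p = smult (inverse (lead_coeff r)) r"
  have "is_min_poly x p"
    using r by (auto simp: is_min_poly_def P_def p_def map_poly_of_rat_smult)
  then show ?thesis
    unfolding min_poly_def using is_min_poly_unique by (metis theI)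
qed

lemma t_hat_rec:
  "t_hat 0 = [:2:]" "t_hat (Suc 0) = [:0, 1:]"
  "t_hat (Suc (Suc n)) = [:0, 1:] * t_hat (Suc n) - t_hat n"
  by (simp_all add: t_hat_def pcompose_diff pcompose_mult pcompose_pCons smult_diff_right
      pcompose_smult flip: pCons_one)

lemma degree_t_hat: "degree (t_hat n) = n \<and> (n > 0 \<longrightarrow> lead_coeff (t_hat n) = 1)"
proof (induction n rule: chebyshev_T.induct)
  case (3 n)
  let ?a = "pCons 0 (t_hat (Suc n))"
  have 1: "coeff (t_hat (Suc n)) (Suc n) = 1" using 3 by (metis zero_less_Suc)
  have nz: "t_hat (Suc n) \<noteq> 0" using 3 by auto
  have d: "degree ?a = Suc (Suc n)" using nz 3 by simp
  have eq: "t_hat (Suc (Suc n)) = ?a + - t_hat n" by (simp add: t_hat_rec)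
  have lt: "degree (- t_hat n) < degree ?a" using d 3 by simp
  have "degree (t_hat (Suc (Suc n))) = Suc (Suc n)"
    unfolding eq using degree_add_eq_left[OF lt] d by simp
  moreover have "coeff (t_hat (Suc (Suc n))) (Suc (Suc n)) = 1"
    unfolding eq using 1 3 by (simp add: coeff_eq_0)
  ultimately show ?case by simp
qed (simp_all add: t_hat_rec)

lemma poly_t_hat_cos:
  "poly (map_poly of_rat (t_hat n)) (2 * cos t :: real) = 2 * cos (real n * t)"
proof (induction n rule: chebyshev_T.induct)
  case (3 n)
  have a: "cos (real (Suc (Suc n)) * t) = cos (real (Suc n) * t + t)"
    and b: "cos (real n * t) = cos (real (Suc n) * t - t)"
    by (simp_all add: algebra_simps)
  have "map_poly of_rat ([:0, 1:] * t_hat (Suc n))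
      = ([:0, 1:] * map_poly of_rat (t_hat (Suc n)) :: real poly)"
    by (simp add: map_poly_pCons)
  then have "poly (map_poly of_rat (t_hat (Suc (Suc n)))) (2 * cos t)
      = 2 * cos t * (2 * cos (real (Suc n) * t)) - 2 * cos (real n * t)"
    using 3 by (simp add: t_hat_rec(3) map_poly_of_rat_diff del: mult_pCons_left)
  also have "\<dots> = 2 * cos (real (Suc (Suc n)) * t)"
    unfolding a b cos_add cos_diff by (simp add: algebra_simps)
  finally show ?case .
qed (simp_all add: t_hat_rec map_poly_pCons)

lemma is_min_poly_C_poly:
  assumes "n \<ge> 1"
  shows "is_min_poly (2 * cos (pi / real n) :: real) (C_poly n)"
  unfolding C_poly_def
proof (rule is_min_poly_min_poly)
  show "t_hat n + [:2:] \<noteq> 0"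
    using degree_t_hat[of n] assms
    by (metis add_eq_0_iff2 degree_minus degree_pCons_0 not_one_le_zero)
  show "poly (map_poly of_rat (t_hat n + [:2:])) (2 * cos (pi / real n) :: real) = 0"
    using assms by (simp add: map_poly_of_rat_add poly_t_hat_cos map_poly_pCons)
qed

end

theory Submission
  imports Defs "Berlekamp_Zassenhaus.Factor_Bound"
begin

text \<open>The roots of \<open>t_hat r\<close> are the numbers \<open>2 cos (c\<pi>/(2r))\<close> with \<open>c\<close> odd and \<open>0 < c < 2r\<close>. As
  \<open>m = n\<^sub>A b\<close> with the odd number \<open>b = \<Prod>j\<notin>A. p\<^sub>j\<close>, the roots of \<open>t_hat n\<^sub>A\<close> are the
  \<open>2 cos (a\<pi>/(2m))\<close> with \<open>a\<close> odd, \<open>0 < a < 2m\<close> and \<open>b\<close> dividing \<open>a\<close>. Inclusion--exclusion over \<open>A\<close>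
  leaves exactly those \<open>a\<close> that no \<open>p\<^sub>j\<close> divides, that is, those coprime to \<open>2m\<close>. These give the roots
  of \<open>C(2m,x)\<close>: irreducibility excludes all others, because each of them is a root of some \<open>t_hat d\<close>
  with \<open>d < m\<close>, and that they are conjugate to \<open>2 cos (\<pi>/(2m))\<close> is Landau's argument for the
  irreducibility of cyclotomic polynomials, carried over to \<open>t_hat\<close> in place of powers.\<close>

interpretation of_rat_poly_hom: map_poly_inj_idom_divide_hom of_rat ..

section \<open>Minimal polynomials\<close>

text \<open>The remainder of \<open>q\<close> modulo \<open>p\<close> also vanishes at
  \<open>x\<close> but has smaller degree than \<open>p\<close>, so minimality makes it
  zero.\<close>

lemma is_min_poly_dvd:
  assumes "is_min_poly x p" "poly (map_poly of_rat q) x = 0"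
  shows "p dvd q"
proof -
  have p0: "p \<noteq> 0" using assms(1) by (auto simp: is_min_poly_def)
  have "map_poly of_rat q
      = (map_poly of_rat (q div p) * map_poly of_rat p + map_poly of_rat (q mod p) :: 'a poly)"
    by (metis div_mult_mod_eq of_rat_poly_hom.hom_add of_rat_poly_hom.hom_mult)
  then have "poly (map_poly of_rat (q mod p)) x = 0"
    using assms by (simp add: is_min_poly_def)
  then have "q mod p = 0"
    using assms(1) degree_mod_less'[OF p0, of q] unfolding is_min_poly_def
    by (meson linorder_not_le)
  then show ?thesis by (simp add: mod_eq_0_iff_dvd)
qed

text \<open>Irreducibility in disguise: the minimal polynomial \<open>p'\<close> of \<open>y\<close>
  divides \<open>p\<close>, say \<open>p = p' * h\<close>, and \<open>x\<close> is a root of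
  \<open>p'\<close> or of \<open>h\<close>. Either way minimality of \<open>p\<close> at
  \<open>x\<close> bounds a degree.\<close>

lemma is_min_poly_other_root:
  fixes x y :: "'a::field_char_0"
  assumes "is_min_poly x p" "poly (map_poly of_rat p) y = 0"
  shows "is_min_poly y p"
proof -
  have p0: "p \<noteq> 0" using assms(1) by (auto simp: is_min_poly_def)
  define p' where "p' = min_poly y"
  have p': "is_min_poly y p'"
    unfolding p'_def using is_min_poly_min_poly[OF p0 assms(2)] .
  obtain h where h: "p = p' * h" using is_min_poly_dvd[OF p' assms(2)] by (auto elim: dvdE)
  have nz: "p' \<noteq> 0" "h \<noteq> 0" using p0 h by auto
  have "degree p \<le> degree p'"
  proof (cases "poly (map_poly of_rat h) x = 0")
    case True
    then have "degree p \<le> degree h" using assms(1) nz by (auto simp: is_min_poly_def)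
    then have "degree p' = 0" using h nz by (simp add: degree_mult_eq)
    moreover have "lead_coeff p' = 1" using p' by (simp add: is_min_poly_def)
    \<comment> \<open>A constant monic \<open>p'\<close> is impossible, since \<open>y\<close> is a
      root of it.\<close>
    ultimately have "p' = 1" by (metis degree_eq_zeroE lead_coeff_pCons(2) one_pCons)
    then show ?thesis using p' by (simp add: is_min_poly_def)
  next
    case False
    then have "poly (map_poly of_rat p') x = 0"
      using assms(1) h by (auto simp: is_min_poly_def of_rat_poly_hom.hom_mult)
    then show ?thesis using assms(1) nz by (auto simp: is_min_poly_def)
  qed
  then show ?thesis
    using assms p' unfolding is_min_poly_def by (meson le_trans)
qed

section \<open>Integrality\<close>

text \<open>Gauss's lemma: the primitive integer multiple \<open>F\<close> of \<open>f\<close>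
  divides \<open>T\<close> over the integers, so its leading coefficient is a unit; as the scaling
  factor \<open>r\<close> is positive, \<open>F\<close> is \<open>f\<close> itself.\<close>

lemma monic_factor_of_int_poly:
  fixes f g :: "rat poly"
  assumes "of_int_poly T = f * g" "lead_coeff T = 1" "lead_coeff f = 1"
  obtains F where "f = of_int_poly F" "lead_coeff F = 1" "degree F = degree f"
proof -
  obtain r F where rF: "rat_to_normalized_int_poly f = (r, F)" by fastforce
  note F = rat_to_normalized_int_poly[OF rF]
  obtain u where u: "T = F * u"
    using rat_to_int_factor_explicit[OF assms(1) rF] by blast
  have "lead_coeff F dvd 1"
    using assms(2) unfolding u lead_coeff_mult by (metis dvd_triv_left)
  then have "lead_coeff F = 1 \<or> lead_coeff F = - 1" by (simp only: zdvd1_eq) linarith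
  moreover have "r * of_int (lead_coeff F) = 1"
    using arg_cong[OF F(1), of "\<lambda>q. poly.coeff q (degree F)"] F(4) assms(3) by simp
  ultimately have "r = 1" "lead_coeff F = 1" using F(2) by auto
  then have "f = of_int_poly F" using F(1) by simp
  then show thesis using that[of F] F(4) \<open>lead_coeff F = 1\<close> by blast
qed

text \<open>The recursion of \<open>t_hat\<close> over the integers, where congruences modulo a
  prime make sense.\<close>

fun t_hat_int :: "nat \<Rightarrow> int poly" where
  "t_hat_int 0 = [:2:]"
| "t_hat_int (Suc 0) = [:0, 1:]"
| "t_hat_int (Suc (Suc n)) = [:0, 1:] * t_hat_int (Suc n) - t_hat_int n"

lemma t_hat_eq_of_int_poly: "t_hat n = of_int_poly (t_hat_int n)"
  by (induction n rule: t_hat_int.induct)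
     (simp_all add: t_hat_rec hom_distribs of_int_poly_hom.hom_minus)

lemma lead_coeff_t_hat_int: "n > 0 \<Longrightarrow> lead_coeff (t_hat_int n) = 1"
  using degree_t_hat[of n] unfolding t_hat_eq_of_int_poly by auto

section \<open>Congruences modulo a prime\<close>

lemma of_nat_dvd_int_poly_iff:
  "(of_nat p :: int poly) dvd f \<longleftrightarrow> (\<forall>i. int p dvd poly.coeff f i)"
  by (simp add: of_nat_poly const_poly_dvd_iff)

lemma prime_dvd_binomial:
  assumes "prime p" "0 < j" "j < p"
  shows "p dvd (p choose j)"
proof -
  have "j * (p choose j) = p * (p - 1 choose (j - 1))"
    using assms times_binomial_minus1_eq[of j p] by simp
  then have "p dvd j * (p choose j)" by simp
  then show ?thesis
    using assms by (simp add: prime_dvd_mult_iff nat_dvd_not_less)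
qed

text \<open>The coefficients \<open>c\<close> are arbitrary so that this serves both the binomial
  theorem and the expansion of a power of the variable in terms of \<open>t_hat_int\<close>.\<close>

lemma prime_dvd_binomial_sum_diff:
  fixes c :: "nat \<Rightarrow> 'a::comm_ring_1"
  assumes "prime p"
  shows "of_nat p dvd (\<Sum>j\<le>p. of_nat (p choose j) * c j) - (c 0 + c p)"
proof -
  have p: "p > 0" using assms prime_gt_0_nat by blast
  have "{..p} = insert 0 (insert p {0<..<p})" using p by auto
  then have "(\<Sum>j\<le>p. of_nat (p choose j) * c j) - (c 0 + c p)
      = (\<Sum>j\<in>{0<..<p}. of_nat (p choose j) * c j)"
    using p by simp
  also have "of_nat p dvd \<dots>"
  proof (rule dvd_sum)
    fix j assume "j \<in> {0<..<p}"
    then have "(of_nat p :: 'a) dvd of_nat (p choose j)"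
      using prime_dvd_binomial[OF assms] by (metis dvd_def greaterThanLessThan_iff of_nat_mult)
    then show "(of_nat p :: 'a) dvd of_nat (p choose j) * c j" by simp
  qed
  finally show ?thesis .
qed

lemma prime_dvd_power_add_diff:
  fixes a b :: "'a::comm_ring_1"
  assumes "prime p"
  shows "of_nat p dvd (a + b) ^ p - (a ^ p + b ^ p)"
  using prime_dvd_binomial_sum_diff[OF assms, of "\<lambda>j. a ^ j * b ^ (p - j)"]
  by (simp add: binomial_ring mult.assoc add.commute)

text \<open>Fermat's little theorem: induction with the additivity of the \<open>p\<close>-th power
  modulo \<open>p\<close> covers natural numbers, and reduction modulo \<open>p\<close> the
  remaining integers.\<close>

lemma prime_dvd_power_diff_int:
  assumes "prime p"
  shows "int p dvd a ^ p - a"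
proof -
  have pos: "int p dvd int n ^ p - int n" for n
  proof (induction n)
    case 0
    then show ?case using assms prime_gt_0_nat[of p] by (simp add: power_0_left)
  next
    case (Suc n)
    have "int p dvd ((int n + 1) ^ p - (int n ^ p + 1 ^ p)) + (int n ^ p - int n)"
      using prime_dvd_power_add_diff[OF assms, of "int n" 1] Suc by (intro dvd_add) auto
    then show ?case by (simp add: algebra_simps)
  qed
  define n where "n = nat (a mod int p)"
  have n: "int n = a mod int p" using assms prime_gt_0_nat[of p] by (simp add: n_def)
  have "[a ^ p - a = int n ^ p - int n] (mod int p)"
    unfolding n by (intro cong_diff cong_pow) (simp_all add: cong_def)
  then show ?thesis using pos cong_dvd_iff by blast
qed

section \<open>Frobenius congruence for \<open>t_hat\<close>\<close>

text \<open>Extended to negative indices by symmetry, as \<open>y ^ a + 1 / y ^ a\<close> suggests,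
  the sequence satisfies its recursion at every integer; at \<open>a = 0\<close> it reads
  \<open>2 x = x + x\<close>.\<close>

lemma X_mult_t_hat_int:
  "[:0, 1:] * t_hat_int (nat \<bar>a\<bar>) = t_hat_int (nat \<bar>a + 1\<bar>) + t_hat_int (nat \<bar>a - 1\<bar>)"
proof -
  have *: "[:0, 1:] * t_hat_int (Suc n) = t_hat_int (Suc (Suc n)) + t_hat_int n" for n
    by simp
  consider "a = 0" | n where "a = 1 + int n" | n where "a = - 1 - int n"
  proof (cases a "0::int" rule: linorder_cases)
    case less
    then show thesis using that(3)[of "nat (- a - 1)"] by simp
  next
    case greater
    then show thesis using that(2)[of "nat (a - 1)"] by simp
  qed (use that(1) in simp)
  then show ?thesis
  proof cases
    case 1
    then show ?thesis by (simp flip: numeral_poly)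
  next
    case 2
    then have "nat \<bar>a\<bar> = Suc n" "nat \<bar>a + 1\<bar> = Suc (Suc n)" "nat \<bar>a - 1\<bar> = n" by auto
    then show ?thesis using * by metis
  next
    case 3
    then have "nat \<bar>a\<bar> = Suc n" "nat \<bar>a - 1\<bar> = Suc (Suc n)" "nat \<bar>a + 1\<bar> = n" by auto
    then show ?thesis using * by (metis add.commute)
  qed
qed

text \<open>The binomial expansion of \<open>2 (y + 1/y) ^ n\<close> with opposite powers of \<open>y\<close> collected: under
  \<open>x = y + 1/y\<close>, \<open>t_hat k\<close> becomes \<open>y ^ k + 1 / y ^ k\<close>.\<close>

lemma X_power_t_hat_int:
  "2 * [:0, 1:] ^ n = (\<Sum>j\<le>n. of_nat (n choose j) * t_hat_int (nat \<bar>int n - 2 * int j\<bar>))"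
proof (induction n)
  case 0
  then show ?case by (simp add: numeral_poly)
next
  case (Suc n)
  define T where "T = (\<lambda>a. t_hat_int (nat \<bar>a\<bar>))"
  have T: "[:0, 1:] * T a = T (a + 1) + T (a - 1)" for a
    unfolding T_def by (rule X_mult_t_hat_int)
  have "2 * [:0, 1:] ^ Suc n = [:0, 1:] * (2 * [:0, 1:] ^ n :: int poly)"
    by (simp only: power_Suc mult.left_commute)
  also have "\<dots> = (\<Sum>j\<le>n. of_nat (n choose j) * ([:0, 1:] * T (int n - 2 * int j)))"
    unfolding Suc T_def sum_distrib_left by (simp only: mult.left_commute)
  also have "\<dots> = (\<Sum>j\<le>n. of_nat (n choose j) * T (int (Suc n) - 2 * int j))
      + (\<Sum>j\<le>n. of_nat (n choose j) * T (int (Suc n) - 2 * int (Suc j)))"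
    unfolding T by (simp add: algebra_simps sum.distrib)
  \<comment> \<open>Shifting the first sum by one aligns it with the second, ready for Pascal's
    rule; the term added at \<open>j = Suc n\<close> has binomial coefficient zero.\<close>
  also have "(\<Sum>j\<le>n. of_nat (n choose j) * T (int (Suc n) - 2 * int j))
      = T (int (Suc n)) + (\<Sum>j\<le>n. of_nat (n choose Suc j) * T (int (Suc n) - 2 * int (Suc j)))"
  proof -
    have "(\<Sum>j\<le>n. of_nat (n choose j) * T (int (Suc n) - 2 * int j))
        = (\<Sum>j\<le>Suc n. of_nat (n choose j) * T (int (Suc n) - 2 * int j))"
      by simp
    also have "\<dots> = T (int (Suc n)) + (\<Sum>j\<le>n. of_nat (n choose Suc j) * T (int (Suc n) - 2 * int (Suc j)))"
      by (subst sum.atMost_Suc_shift) simp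
    finally show ?thesis .
  qed
  also have "T (int (Suc n)) + (\<Sum>j\<le>n. of_nat (n choose Suc j) * T (int (Suc n) - 2 * int (Suc j)))
      + (\<Sum>j\<le>n. of_nat (n choose j) * T (int (Suc n) - 2 * int (Suc j)))
      = T (int (Suc n)) + (\<Sum>j\<le>n. of_nat (Suc n choose Suc j) * T (int (Suc n) - 2 * int (Suc j)))"
    by (simp add: sum.distrib[symmetric] algebra_simps)
  also have "\<dots> = (\<Sum>j\<le>Suc n. of_nat (Suc n choose j) * T (int (Suc n) - 2 * int j))"
    by (subst sum.atMost_Suc_shift) simp
  finally show ?case unfolding T_def .
qed

text \<open>Modulo \<open>p\<close> only the end terms \<open>j = 0\<close> and \<open>j = p\<close>
  of the expansion of \<open>2 * [:0, 1:] ^ p\<close> survive, and both are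
  \<open>t_hat_int p\<close>; the factor 2 cancels because \<open>p\<close> is odd.\<close>

lemma prime_dvd_t_hat_int_diff:
  assumes "prime p" "odd p"
  shows "of_nat p dvd t_hat_int p - [:0, 1:] ^ p"
proof -
  have "of_nat p dvd 2 * [:0, 1:] ^ p - (t_hat_int p + t_hat_int p)"
    using prime_dvd_binomial_sum_diff[OF assms(1), of "\<lambda>j. t_hat_int (nat \<bar>int p - 2 * int j\<bar>)"]
    unfolding X_power_t_hat_int by simp
  also have "\<dots> = - (2 * (t_hat_int p - [:0, 1:] ^ p))" by (simp add: algebra_simps)
  finally have "of_nat p dvd [:2:] * (t_hat_int p - [:0, 1:] ^ p)"
    by (simp only: dvd_minus_iff numeral_poly)
  then have "int p dvd 2 * poly.coeff (t_hat_int p - [:0, 1:] ^ p) i" for i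
    unfolding of_nat_dvd_int_poly_iff by simp
  moreover have "algebraic_semidom_class.coprime (int p) 2" using assms by simp
  ultimately show ?thesis
    unfolding of_nat_dvd_int_poly_iff using coprime_dvd_mult_right_iff by blast
qed

text \<open>Modulo \<open>p\<close>, composing with \<open>t_hat_int p\<close> is substituting the
  \<open>p\<close>-th power of the variable, which for integer coefficients is the Frobenius
  map.\<close>

lemma prime_dvd_pcompose_t_hat_int_diff:
  assumes "prime p" "odd p"
  shows "of_nat p dvd F \<circ>\<^sub>p t_hat_int p - F ^ p"
proof (induction F)
  case 0
  then show ?case using assms prime_gt_0_nat[of p] by (simp add: power_0_left)
next
  case (pCons a F)
  let ?X = "[:0, 1:] :: int poly"
  have F: "pCons a F = [:a:] + ?X * F" by simp
  have 1: "of_nat p dvd (t_hat_int p - ?X ^ p) * (F \<circ>\<^sub>p t_hat_int p)"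
    using prime_dvd_t_hat_int_diff[OF assms] by simp
  have 2: "of_nat p dvd ?X ^ p * (F \<circ>\<^sub>p t_hat_int p - F ^ p)"
    using pCons.IH by simp
  have 3: "of_nat p dvd ([:a:] + ?X * F) ^ p - ([:a:] ^ p + (?X * F) ^ p)"
    by (rule prime_dvd_power_add_diff[OF assms(1)])
  have "of_nat p dvd [:a ^ p - a:]"
    using prime_dvd_power_diff_int[OF assms(1)] by (simp add: of_nat_poly)
  then have 4: "of_nat p dvd [:a:] ^ p - [:a:]" by (simp add: poly_const_pow)
  \<comment> \<open>The four multiples of \<open>p\<close> come from replacing
    \<open>t_hat_int p\<close> by the power, the induction hypothesis, additivity of the
    \<open>p\<close>-th power, and Fermat for \<open>a\<close>.\<close>
  have "pCons a F \<circ>\<^sub>p t_hat_int p - pCons a F ^ p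
      = (t_hat_int p - ?X ^ p) * (F \<circ>\<^sub>p t_hat_int p) + ?X ^ p * (F \<circ>\<^sub>p t_hat_int p - F ^ p)
        - (([:a:] + ?X * F) ^ p - ([:a:] ^ p + (?X * F) ^ p)) - ([:a:] ^ p - [:a:])"
    unfolding F pcompose_add pcompose_mult power_mult_distrib by (simp add: algebra_simps pcompose_pCons)
  then show ?case by (simp only: dvd_add dvd_diff 1 2 3 4)
qed

section \<open>Conjugates\<close>

lemma map_poly_of_rat_of_int_poly: "map_poly of_rat (of_int_poly q) = of_int_poly q"
  by (intro poly_eqI) (simp add: coeff_map_poly)

text \<open>Two distinct such \<open>r\<close> with equal values at \<open>x\<close> would differ by
  a nonzero polynomial of degree below that of \<open>F\<close> vanishing at \<open>x\<close>. So
  evaluation at \<open>x\<close> embeds the set into \<open>V\<close>.\<close>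

lemma finite_int_poly_values:
  fixes x :: real
  assumes "is_min_poly x (of_int_poly F)" "finite V"
  shows "finite {r :: int poly. (r = 0 \<or> degree r < degree F) \<and> poly (of_int_poly r) x \<in> V}"
    (is "finite ?R")
proof -
  have "inj_on (\<lambda>r. poly (of_int_poly r) x) ?R"
  proof (rule inj_onI, rule ccontr)
    fix r s assume r: "r \<in> ?R" and s: "s \<in> ?R" and "r \<noteq> s"
      and eq: "poly (of_int_poly r) x = poly (of_int_poly s) x"
    have "of_int_poly (r - s) \<noteq> (0 :: rat poly)" using \<open>r \<noteq> s\<close> by simp
    moreover have "poly (map_poly of_rat (of_int_poly (r - s) :: rat poly)) x = 0"
      unfolding map_poly_of_rat_of_int_poly using eq by (simp add: of_int_poly_hom.hom_minus)
    ultimately have "degree F \<le> degree (r - s)"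
      using assms(1) unfolding is_min_poly_def by (metis of_int_hom.degree_map_poly_hom)
    moreover have "degree (r - s) < degree F"
      using r s \<open>r \<noteq> s\<close> degree_diff_le_max[of r s] by auto
    ultimately show False by simp
  qed
  moreover have "(\<lambda>r. poly (of_int_poly r) x) ` ?R \<subseteq> V" by auto
  ultimately show ?thesis using assms(2) by (meson finite_imageD finite_subset)
qed

text \<open>Landau's argument: the remainder of \<open>F \<circ> t_hat p\<close> modulo \<open>F\<close> is divisible by \<open>p\<close>, because
  \<open>F \<circ> t_hat p\<close> is congruent to \<open>F ^ p\<close>, but it is determined by its value \<open>F (2 cos (p \<theta>))\<close> at
  \<open>2 cos \<theta>\<close>, so that only finitely many remainders occur. For large \<open>p\<close> it is therefore zero.\<close>

lemma dvd_pcompose_t_hat_large_prime: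
  fixes \<theta> :: real
  assumes min: "is_min_poly (2 * cos \<theta>) (of_int_poly F)" and monic: "lead_coeff F = 1"
    and fin: "finite (range (\<lambda>k::nat. cos (real k * \<theta>)))"
  obtains A where "\<And>p. prime p \<Longrightarrow> p > A \<Longrightarrow> F dvd F \<circ>\<^sub>p t_hat_int p"
proof -
  define V where "V = (\<lambda>y. poly (of_int_poly F) (2 * y)) ` range (\<lambda>k::nat. cos (real k * \<theta>))"
  define R where "R = {r :: int poly. (r = 0 \<or> degree r < degree F)
    \<and> poly (of_int_poly r) (2 * cos \<theta>) \<in> V}"
  have "finite V" using fin by (simp add: V_def)
  then have "finite R" unfolding R_def by (rule finite_int_poly_values[OF min])
  then have "finite ((\<lambda>r. nat \<bar>lead_coeff r\<bar>) ` R)" by simp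
  then obtain B where B: "\<And>r. r \<in> R \<Longrightarrow> nat \<bar>lead_coeff r\<bar> \<le> B"
    unfolding finite_nat_set_iff_bounded_le by blast
  show thesis
  proof
    \<comment> \<open>The bound makes \<open>p\<close> odd as well as larger than every leading
      coefficient occurring in \<open>R\<close>.\<close>
    fix p assume p: "prime p" "p > max 2 B"
    have "odd p" using p prime_odd_nat by auto
    then obtain h where h: "F \<circ>\<^sub>p t_hat_int p - F ^ p = of_nat p * h"
      using prime_dvd_pcompose_t_hat_int_diff[OF p(1), of F] by (auto elim: dvdE)
    \<comment> \<open>As \<open>F\<close> is monic, pseudo-division over the integers is ordinary
      division with remainder.\<close>
    obtain q s where qs: "pseudo_divmod h F = (q, s)" by fastforce
    have "F \<noteq> 0" using monic by auto
    from pseudo_divmod[OF this qs] have hqs: "h = F * q + s" and s: "s = 0 \<or> degree s < degree F"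
      using monic by simp_all
    have eq: "F \<circ>\<^sub>p t_hat_int p = F ^ p + of_nat p * (F * q + s)" using h hqs by (simp add: algebra_simps)
    have root: "poly (of_int_poly F) (2 * cos \<theta>) = 0"
      using min by (simp add: is_min_poly_def map_poly_of_rat_of_int_poly)
    have smult: "of_nat p * s = Polynomial.smult (int p) s" by (simp add: of_nat_poly)
    have "poly (of_int_poly (of_nat p * s)) (2 * cos \<theta>)
        = poly (of_int_poly (F \<circ>\<^sub>p t_hat_int p)) (2 * cos \<theta>)"
      unfolding eq using root p(1) prime_gt_0_nat[of p]
      by (simp add: hom_distribs power_0_left)
    also have "\<dots> = poly (of_int_poly F) (2 * cos (real p * \<theta>))"
      using poly_t_hat_cos[of p \<theta>]
      by (simp add: of_int_hom.map_poly_pcompose poly_pcompose t_hat_eq_of_int_poly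
          map_poly_of_rat_of_int_poly)
    finally have "of_nat p * s \<in> R"
      using s p(1) prime_gt_0_nat[of p] unfolding R_def V_def smult by auto
    from B[OF this] have "nat \<bar>int p * lead_coeff s\<bar> \<le> B" unfolding smult by (simp split: if_splits)
    \<comment> \<open>Otherwise the leading coefficient of \<open>of_nat p * s\<close> would have
      absolute value at least \<open>p > B\<close>.\<close>
    then have "s = 0"
    proof (rule contrapos_pp)
      assume "s \<noteq> 0"
      then have "1 \<le> \<bar>lead_coeff s\<bar>" by (metis abs_0_eq int_one_le_iff_zero_less leading_coeff_0_iff zero_less_abs_iff)
      then have "int p * 1 \<le> \<bar>int p * lead_coeff s\<bar>"
        unfolding abs_mult by (intro mult_mono) auto
      then show "\<not> nat \<bar>int p * lead_coeff s\<bar> \<le> B" using p(2) by linarith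
    qed
    have "F dvd F ^ p" using p(1) prime_gt_0_nat[of p] by (simp add: dvd_power)
    then show "F dvd F \<circ>\<^sub>p t_hat_int p" unfolding eq \<open>s = 0\<close> by (intro dvd_add) simp_all
  qed
qed

lemma cos_nat_mult_add_period:
  fixes \<theta> :: real
  assumes "real M * \<theta> = 2 * pi"
  shows "cos (real (k + M * q) * \<theta>) = cos (real k * \<theta>)"
proof -
  have "real (k + M * q) * \<theta> = real k * \<theta> + real q * (real M * \<theta>)" by (simp add: algebra_simps)
  also have "\<dots> = real k * \<theta> + 2 * pi * real_of_int (int q)" using assms by simp
  finally show ?thesis by (simp only: cos_add cos_int_2pin sin_int_2pin mult_1_right mult_zero_right diff_zero)
qed

text \<open>Each large prime \<open>p\<close> carries a root \<open>2 cos (c \<theta>)\<close> to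
  the root \<open>2 cos (p c \<theta>)\<close>. Adding a multiple of the period \<open>M\<close> to
  \<open>a\<close> leaves the cosine unchanged and can remove all small prime factors.\<close>

lemma root_conjugate:
  fixes \<theta> :: real
  assumes min: "is_min_poly (2 * cos \<theta>) (of_int_poly F)" and monic: "lead_coeff F = 1"
    and M: "real M * \<theta> = 2 * pi" and a: "gcd a M = 1"
  shows "poly (of_int_poly F) (2 * cos (real a * \<theta>)) = 0"
proof -
  have "M > 0" using M by (cases M) auto
  have "range (\<lambda>k::nat. cos (real k * \<theta>)) \<subseteq> (\<lambda>k. cos (real k * \<theta>)) ` {..<M}"
  proof clarify
    fix k
    have "cos (real k * \<theta>) = cos (real (k mod M) * \<theta>)"
      using cos_nat_mult_add_period[OF M, of "k mod M" "k div M"] by simp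
    then show "cos (real k * \<theta>) \<in> (\<lambda>k. cos (real k * \<theta>)) ` {..<M}" using \<open>M > 0\<close> by auto
  qed
  then have fin: "finite (range (\<lambda>k::nat. cos (real k * \<theta>)))" by (rule finite_subset) simp
  obtain A where A: "\<And>p. prime p \<Longrightarrow> p > A \<Longrightarrow> F dvd F \<circ>\<^sub>p t_hat_int p"
    using dvd_pcompose_t_hat_large_prime[OF min monic fin] by blast
  have large: "poly (of_int_poly F) (2 * cos (real b * \<theta>)) = 0"
    if "b > 0" "\<And>p. prime p \<Longrightarrow> p dvd b \<Longrightarrow> p > A" for b
    using that
  proof (induction b rule: less_induct)
    case (less b)
    show ?case
    proof (cases "b = 1")
      case True
      then show ?thesis using min by (simp add: is_min_poly_def map_poly_of_rat_of_int_poly)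
    next
      case False
      then obtain p where p: "prime p" "p dvd b" using prime_factor_nat by blast
      then obtain c where c: "b = p * c" by (auto elim: dvdE)
      have "c < b" "c > 0" using c less.prems(1) prime_gt_1_nat[OF p(1)] by auto
      then have "poly (of_int_poly F) (2 * cos (real c * \<theta>)) = 0"
        using less.IH less.prems(2) c by auto
      moreover obtain h where "F \<circ>\<^sub>p t_hat_int p = F * h"
        using A[OF p(1) less.prems(2)[OF p]] by (auto elim: dvdE)
      ultimately have "poly (of_int_poly (F \<circ>\<^sub>p t_hat_int p)) (2 * cos (real c * \<theta>)) = 0"
        by (simp only: of_int_poly_hom.hom_mult poly_mult mult_zero_left)
      then show ?thesis
        using poly_t_hat_cos[of p "real c * \<theta>"]
        by (simp add: c of_int_hom.map_poly_pcompose poly_pcompose t_hat_eq_of_int_poly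
            map_poly_of_rat_of_int_poly mult.assoc)
    qed
  qed
  \<comment> \<open>A prime \<open>p \<le> A\<close> divides exactly one of \<open>a\<close> and
    \<open>M * Q\<close>: if it divides \<open>a\<close>, it divides neither \<open>M\<close> nor
    \<open>Q\<close>; if not, it is a factor of \<open>Q\<close>. Hence it never divides
    \<open>a + M * Q\<close>.\<close>
  define Q where "Q = \<Prod>{q. prime q \<and> q \<le> A \<and> \<not> q dvd a}"
  have finQ: "finite {q. prime q \<and> q \<le> A \<and> \<not> q dvd a}" by (rule finite_subset[of _ "{..A}"]) auto
  have "Q > 0" unfolding Q_def using prime_gt_0_nat by (intro prod_pos) auto
  have "poly (of_int_poly F) (2 * cos (real (a + M * Q) * \<theta>)) = 0"
  proof (rule large)
    fix p assume p: "prime p" "p dvd a + M * Q"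
    show "p > A"
    proof (rule ccontr)
      assume "\<not> A < p"
      show False
      proof (cases "p dvd a")
        case True
        then have "p dvd M * Q" using p(2) by (simp add: dvd_add_right_iff)
        moreover have "\<not> p dvd M" using a True p(1) by (metis gcd_greatest not_prime_unit)
        ultimately have "p dvd Q" using p(1) by (simp add: prime_dvd_mult_iff)
        then obtain q where "prime q" "\<not> q dvd a" "p dvd q"
          unfolding Q_def using prime_dvd_prod_iff[OF finQ p(1)] by auto
        then show False using True p(1) primes_dvd_imp_eq by blast
      next
        case False
        then have "p dvd Q"
          unfolding Q_def using p(1) \<open>\<not> A < p\<close> finQ by (intro dvd_prodI) auto
        then show False using False p(2) by (simp add: dvd_add_left_iff)
      qed
    qed
  qed (use \<open>Q > 0\<close> \<open>M > 0\<close> in simp)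
  then show ?thesis by (simp only: cos_nat_mult_add_period[OF M])
qed

section \<open>Linear factors\<close>

lemma prod_linear_factors_dvd:
  fixes p :: "'a::idom poly"
  assumes "finite X" "\<And>x. x \<in> X \<Longrightarrow> poly p x = 0"
  shows "(\<Prod>x\<in>X. [:- x, 1:]) dvd p"
  using assms
proof (induction X rule: finite_induct)
  case (insert x X)
  then obtain q where q: "p = (\<Prod>x\<in>X. [:- x, 1:]) * q" by (auto elim: dvdE)
  have "poly (\<Prod>x\<in>X. [:- x, 1:]) x \<noteq> 0"
    using insert.hyps by (auto simp: poly_prod)
  then have "poly q x = 0" using insert.prems[of x] q by simp
  then have "[:- x, 1:] dvd q" by (simp add: poly_eq_0_iff_dvd)
  then have "[:- x, 1:] * (\<Prod>x\<in>X. [:- x, 1:]) dvd q * (\<Prod>x\<in>X. [:- x, 1:])"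
    by (rule mult_dvd_mono) simp
  then show ?case unfolding q prod.insert[OF insert.hyps] by (simp only: mult.commute[of q])
qed simp

lemma lead_coeff_prod_linear_factors: "lead_coeff (\<Prod>x\<in>X. [:- x, 1:] :: 'a::idom poly) = 1"
  by (simp add: lead_coeff_prod)

lemma degree_prod_linear_factors: "degree (\<Prod>x\<in>X. [:- x, 1:] :: 'a::idom poly) = card X"
  by (subst degree_prod_eq_sum_degree) auto

lemma monic_dvd_monic_imp_eq:
  fixes p q :: "'a::idom poly"
  assumes "p dvd q" "degree q \<le> degree p" "lead_coeff p = 1" "lead_coeff q = 1"
  shows "p = q"
proof -
  obtain r where r: "q = p * r" using assms(1) dvdE by blast
  have "q \<noteq> 0" using assms(4) by auto
  then have "degree r = 0" using assms(2) r by (auto simp: degree_mult_eq)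
  moreover have "lead_coeff r = 1" using assms(3,4) r by (simp add: lead_coeff_mult)
  ultimately have "r = 1" by (metis degree_eq_zeroE lead_coeff_pCons(2) one_pCons)
  then show ?thesis using r by simp
qed

lemma monic_eq_prod_linear_factors:
  fixes p :: "'a::idom poly"
  assumes "finite X" "\<And>x. x \<in> X \<Longrightarrow> poly p x = 0" "lead_coeff p = 1" "degree p = card X"
  shows "p = (\<Prod>x\<in>X. [:- x, 1:])"
proof (rule sym, rule monic_dvd_monic_imp_eq)
  show "degree p \<le> degree (\<Prod>x\<in>X. [:- x, 1:])"
    by (simp only: assms(4) degree_prod_linear_factors order_refl)
qed (use assms prod_linear_factors_dvd lead_coeff_prod_linear_factors in auto)

text \<open>A degree count: \<open>p\<close> vanishes on \<open>?Y\<close>, its cofactor on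
  \<open>?Z\<close>, and the degrees add up to \<open>card X\<close>, so \<open>p\<close> has degree
  exactly \<open>card ?Y\<close>.\<close>

lemma monic_dvd_prod_linear_factors:
  fixes p :: "'a::idom poly"
  assumes "finite X" "p dvd (\<Prod>x\<in>X. [:- x, 1:])" "lead_coeff p = 1"
  shows "p = (\<Prod>x | x \<in> X \<and> poly p x = 0. [:- x, 1:])"
proof -
  let ?Y = "{x. x \<in> X \<and> poly p x = 0}" and ?Z = "{x. x \<in> X \<and> poly p x \<noteq> 0}"
  obtain q where q: "(\<Prod>x\<in>X. [:- x, 1:]) = p * q" using assms(2) dvdE by blast
  have "(\<Prod>x\<in>X. [:- x, 1:] :: 'a poly) \<noteq> 0" using assms(1) by simp
  then have nz: "p \<noteq> 0" "q \<noteq> 0" using q by auto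
  have "(\<Prod>x\<in>?Z. [:- x, 1:]) dvd q"
  proof (rule prod_linear_factors_dvd)
    fix x assume "x \<in> ?Z"
    moreover from this have "poly (\<Prod>x\<in>X. [:- x, 1:]) x = 0"
      using assms(1) by (auto simp: poly_prod)
    ultimately show "poly q x = 0" using q by simp
  qed (use assms(1) in simp)
  from dvd_imp_degree_le[OF this nz(2)] have "card ?Z \<le> degree q"
    by (simp only: degree_prod_linear_factors)
  moreover have "degree p + degree q = card X"
    using arg_cong[OF q, of degree] degree_mult_eq[OF nz] by (simp only: degree_prod_linear_factors)
  moreover have "card X = card ?Y + card ?Z"
    using assms(1) by (subst card_Un_disjoint[symmetric]) (auto intro: arg_cong[of _ _ card])
  moreover have "(\<Prod>x\<in>?Y. [:- x, 1:]) dvd p"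
    using assms(1) by (intro prod_linear_factors_dvd) auto
  from dvd_imp_degree_le[OF this nz(1)] have "card ?Y \<le> degree p"
    by (simp only: degree_prod_linear_factors)
  ultimately have deg: "degree p = card ?Y" by linarith
  show ?thesis
    by (rule monic_eq_prod_linear_factors[OF _ _ assms(3) deg]) (use assms(1) in simp_all)
qed

section \<open>Real factorization of \<open>t_hat\<close>\<close>

text \<open>For odd \<open>a\<close> this is a linear factor of \<open>t_hat r\<close>. Indexing by
  the integer \<open>a\<close> instead of the root lets divisibility of \<open>a\<close> tell which
  polynomials share the factor.\<close>

definition cos_factor :: "nat \<Rightarrow> nat \<Rightarrow> real poly" where
  "cos_factor r a = [:- (2 * cos (real a * (pi / real (2 * r)))), 1:]"

definition odd_below :: "nat \<Rightarrow> nat set" where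
  "odd_below r = {a. odd a \<and> a < 2 * r}"

lemma finite_odd_below [simp]: "finite (odd_below r)"
  unfolding odd_below_def by (rule finite_subset[of _ "{..<2 * r}"]) auto

lemma card_odd_below: "card (odd_below r) = r"
proof -
  have "odd_below r = (\<lambda>i. 2 * i + 1) ` {..<r}"
    unfolding odd_below_def by (auto elim!: oddE)
  then show ?thesis by (simp add: card_image inj_on_def)
qed

text \<open>The angles lie between 0 and \<open>pi\<close>, where the cosine is injective.\<close>

lemma inj_on_cos_odd_below:
  "inj_on (\<lambda>a. 2 * cos (real a * (pi / real (2 * r)))) (odd_below r)"
proof (cases "r = 0")
  case False
  have range: "0 \<le> real a * (pi / real (2 * r)) \<and> real a * (pi / real (2 * r)) \<le> pi"
    if "a \<in> odd_below r" for a
  proof -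
    have "real a / real (2 * r) \<le> 1" using that by (simp add: odd_below_def)
    then have "real a / real (2 * r) * pi \<le> 1 * pi" by (intro mult_right_mono) auto
    then show ?thesis by simp
  qed
  show ?thesis
  proof (rule inj_onI)
    fix a b assume ab: "a \<in> odd_below r" "b \<in> odd_below r"
      and "2 * cos (real a * (pi / real (2 * r))) = 2 * cos (real b * (pi / real (2 * r)))"
    then have "cos (real a * (pi / real (2 * r))) = cos (real b * (pi / real (2 * r)))" by linarith
    then have "real a * (pi / real (2 * r)) = real b * (pi / real (2 * r))"
      using range[OF ab(1)] range[OF ab(2)] cos_inj_pi by blast
    then show "a = b" using False by simp
  qed
qed (simp add: odd_below_def)

lemma prod_linear_factors_cos:
  assumes "X \<subseteq> odd_below r"
  shows "(\<Prod>x\<in>(\<lambda>a. 2 * cos (real a * (pi / real (2 * r)))) ` X. [:- x, 1:])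
    = (\<Prod>a\<in>X. cos_factor r a)"
  unfolding prod.reindex[OF inj_on_subset[OF inj_on_cos_odd_below assms]] cos_factor_def
  by (simp only: o_def)

lemma cos_odd_half_pi: "odd a \<Longrightarrow> cos (real a * (pi / 2)) = 0"
  unfolding cos_zero_iff by blast

text \<open>The cosine vanishes at odd multiples of \<open>pi / 2\<close>, which gives
  \<open>r\<close> distinct roots of a monic polynomial of degree \<open>r\<close>.\<close>

lemma t_hat_eq_prod_cos_factor:
  assumes "r > 0"
  shows "map_poly of_rat (t_hat r) = (\<Prod>a\<in>odd_below r. cos_factor r a)"
proof -
  let ?f = "\<lambda>a. 2 * cos (real a * (pi / real (2 * r)))"
  have "map_poly of_rat (t_hat r) = (\<Prod>x\<in>?f ` odd_below r. [:- x, 1:])"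
  proof (rule monic_eq_prod_linear_factors)
    fix x assume "x \<in> ?f ` odd_below r"
    then obtain a where a: "odd a" "x = 2 * cos (real a * (pi / real (2 * r)))"
      by (auto simp: odd_below_def)
    have "real r * (real a * (pi / real (2 * r))) = real a * (pi / 2)" using assms by simp
    then show "poly (map_poly of_rat (t_hat r)) x = 0"
      unfolding a(2) poly_t_hat_cos by (simp only: cos_odd_half_pi[OF a(1)] mult_zero_right)
  next
    have "poly.coeff (t_hat r) r = 1" using degree_t_hat[of r] assms by auto
    then show "lead_coeff (map_poly of_rat (t_hat r)) = (1 :: real)"
      "degree (map_poly of_rat (t_hat r) :: real poly) = card (?f ` odd_below r)"
      by (simp_all only: card_image[OF inj_on_cos_odd_below] card_odd_below
          of_rat_hom.coeff_map_poly_hom of_rat_hom.degree_map_poly_hom degree_t_hat of_rat_1)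
  qed simp
  also have "\<dots> = (\<Prod>a\<in>odd_below r. cos_factor r a)"
    by (rule prod_linear_factors_cos) simp
  finally show ?thesis .
qed

text \<open>Scaling \<open>a = c * b\<close> preserves the angle, since
  \<open>a / (2 m) = c / (2 r)\<close>, and preserves parity because \<open>b\<close> is
  odd.\<close>

lemma t_hat_eq_prod_cos_factor_multiples:
  assumes "r * b = m" "odd b" "m > 0"
  shows "map_poly of_rat (t_hat r) = (\<Prod>a | a \<in> odd_below m \<and> b dvd a. cos_factor m a)"
proof -
  have pos: "r > 0" "b > 0" using assms by auto
  have img: "(\<lambda>c. c * b) ` odd_below r = {a. a \<in> odd_below m \<and> b dvd a}"
  proof (intro equalityI subsetI)
    fix a assume "a \<in> (\<lambda>c. c * b) ` odd_below r"
    then show "a \<in> {a. a \<in> odd_below m \<and> b dvd a}"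
      using assms(2) pos unfolding odd_below_def assms(1)[symmetric] by auto
  next
    fix a assume a: "a \<in> {a. a \<in> odd_below m \<and> b dvd a}"
    then obtain c where "a = c * b" by (metis (lifting) dvd_def mem_Collect_eq mult.commute)
    moreover from this have "c \<in> odd_below r"
      using a pos unfolding odd_below_def assms(1)[symmetric] by simp
    ultimately show "a \<in> (\<lambda>c. c * b) ` odd_below r" by blast
  qed
  have "(\<Prod>a | a \<in> odd_below m \<and> b dvd a. cos_factor m a) = (\<Prod>c\<in>odd_below r. cos_factor m (c * b))"
    unfolding img[symmetric] using pos by (subst prod.reindex) (auto simp: inj_on_def)
  also have "\<dots> = (\<Prod>c\<in>odd_below r. cos_factor r c)"
    using pos unfolding cos_factor_def assms(1)[symmetric] by (intro prod.cong) (auto simp: field_simps)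
  finally show ?thesis using t_hat_eq_prod_cos_factor[OF pos(1)] by simp
qed

section \<open>Factorization of \<open>C(2m,x)\<close> and inclusion--exclusion\<close>

lemma is_min_poly_C_poly_double:
  assumes "m \<ge> 1"
  shows "is_min_poly (2 * cos (pi / real (2 * m)) :: real) (C_poly (2 * m))"
  using assms by (intro is_min_poly_C_poly) simp

lemma C_poly_dvd_t_hat:
  assumes "m \<ge> 1"
  shows "C_poly (2 * m) dvd t_hat m"
proof (rule is_min_poly_dvd[OF is_min_poly_C_poly_double[OF assms]])
  have "real m * (pi / real (2 * m)) = pi / 2" using assms by simp
  then show "poly (map_poly of_rat (t_hat m)) (2 * cos (pi / real (2 * m))) = 0"
    unfolding poly_t_hat_cos by (simp only: cos_pi_half mult_zero_right)
qed

lemma C_poly_of_int_poly: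
  assumes "m \<ge> 1"
  obtains F where "C_poly (2 * m) = of_int_poly F" "lead_coeff F = 1"
proof -
  obtain g where g: "of_int_poly (t_hat_int m) = C_poly (2 * m) * g"
    using C_poly_dvd_t_hat[OF assms] unfolding t_hat_eq_of_int_poly by (rule dvdE)
  have "lead_coeff (t_hat_int m) = 1" using assms by (intro lead_coeff_t_hat_int) simp
  moreover have "lead_coeff (C_poly (2 * m)) = 1"
    using is_min_poly_C_poly_double[OF assms] by (simp add: is_min_poly_def)
  ultimately show thesis using that by (rule monic_factor_of_int_poly[OF g])
qed

text \<open>Coprime \<open>a\<close> give conjugates by \<open>root_conjugate\<close>. Conversely,
  with \<open>g = gcd a m\<close>, a root would force \<open>C_poly (2 * m)\<close> to divide
  \<open>t_hat (m / g)\<close>, whose value at \<open>2 cos (pi / (2 m))\<close> is nonzero unless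
  \<open>g = 1\<close>.\<close>

lemma C_poly_root_iff:
  assumes "m \<ge> 1" "a \<in> odd_below m"
  shows "poly (map_poly of_rat (C_poly (2 * m))) (2 * cos (real a * (pi / real (2 * m)))) = 0
    \<longleftrightarrow> gcd a m = 1"
proof -
  let ?\<theta> = "pi / real (2 * m)"
  note min = is_min_poly_C_poly_double[OF assms(1)]
  have "odd a" using assms by (simp add: odd_below_def)
  show ?thesis
  proof
    assume "gcd a m = 1"
    obtain F where F: "C_poly (2 * m) = of_int_poly F" "lead_coeff F = 1"
      using C_poly_of_int_poly[OF assms(1)] by blast
    \<comment> \<open>The multiples of \<open>?\<theta>\<close> have period \<open>4 m\<close>
      modulo \<open>2 pi\<close>, so \<open>a\<close> must be coprime to \<open>4 m\<close>; oddness
      supplies the factor 4.\<close>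
    have "algebraic_semidom_class.coprime a (2 * (2 * m))"
      using \<open>odd a\<close> coprime_iff_gcd_eq_1[THEN iffD2, OF \<open>gcd a m = 1\<close>]
      by (simp only: coprime_mult_right_iff coprime_right_2_iff_odd simp_thms)
    then have "gcd a (2 * (2 * m)) = 1" by (rule coprime_imp_gcd_eq_1)
    then show "poly (map_poly of_rat (C_poly (2 * m))) (2 * cos (real a * ?\<theta>)) = 0"
      using root_conjugate[of ?\<theta> F "2 * (2 * m)" a] min F assms(1)
      by (simp add: map_poly_of_rat_of_int_poly)
  next
    define g where "g = gcd a m"
    assume root: "poly (map_poly of_rat (C_poly (2 * m))) (2 * cos (real a * ?\<theta>)) = 0"
    obtain a' where a': "a = g * a'" unfolding g_def by (meson dvdE gcd_dvd1)
    obtain d where d: "m = g * d" unfolding g_def by (meson dvdE gcd_dvd2)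
    have "odd g" "odd a'" using \<open>odd a\<close> a' by auto
    have pos: "g > 0" "d > 0" using d assms(1) by (auto intro: Nat.gr0I)
    have "real d * (real a * ?\<theta>) = real a' * (pi / 2)" using pos unfolding a' d by simp
    then have "poly (map_poly of_rat (t_hat d)) (2 * cos (real a * ?\<theta>)) = 0"
      unfolding poly_t_hat_cos by (simp only: cos_odd_half_pi[OF \<open>odd a'\<close>] mult_zero_right)
    then have "C_poly (2 * m) dvd t_hat d"
      by (rule is_min_poly_dvd[OF is_min_poly_other_root[OF min root]])
    then have "poly (map_poly of_rat (t_hat d)) (2 * cos ?\<theta>) = 0"
      using min by (auto simp: is_min_poly_def of_rat_poly_hom.hom_mult elim!: dvdE)
    then have "cos (real d * ?\<theta>) = 0" unfolding poly_t_hat_cos by simp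
    moreover have "real d * ?\<theta> = pi / (2 * real g)" using pos unfolding d by (simp add: field_simps)
    ultimately have "cos (pi / (2 * real g)) = 0" by simp
    moreover have "cos (pi / (2 * real g)) > 0" if "g > 1"
      using that by (intro cos_gt_zero) (simp_all add: field_simps)
    ultimately show "gcd a m = 1" using pos unfolding g_def[symmetric] by (metis less_irrefl less_one nat_neq_iff)
  qed
qed

lemma C_poly_eq_prod_cos_factor:
  assumes "m \<ge> 1"
  shows "map_poly of_rat (C_poly (2 * m)) = (\<Prod>a | a \<in> odd_below m \<and> gcd a m = 1. cos_factor m a)"
proof -
  let ?f = "\<lambda>a. 2 * cos (real a * (pi / real (2 * m)))"
  note min = is_min_poly_C_poly_double[OF assms]
  have "map_poly of_rat (C_poly (2 * m)) dvd (map_poly of_rat (t_hat m) :: real poly)"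
    by (rule of_rat_poly_hom.hom_dvd[OF C_poly_dvd_t_hat[OF assms]])
  also have "\<dots> = (\<Prod>x\<in>?f ` odd_below m. [:- x, 1:])"
    unfolding prod_linear_factors_cos[OF order_refl] using assms
    by (intro t_hat_eq_prod_cos_factor) simp
  finally have "map_poly of_rat (C_poly (2 * m)) = (\<Prod>x | x \<in> ?f ` odd_below m
      \<and> poly (map_poly of_rat (C_poly (2 * m))) x = 0. [:- x, 1:])"
    by (rule monic_dvd_prod_linear_factors[rotated]) (use min in \<open>auto simp: is_min_poly_def\<close>)
  also have "{x. x \<in> ?f ` odd_below m \<and> poly (map_poly of_rat (C_poly (2 * m))) x = 0}
      = ?f ` {a. a \<in> odd_below m \<and> gcd a m = 1}"
    using C_poly_root_iff[OF assms] by auto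
  also have "(\<Prod>x\<in>?f ` {a. a \<in> odd_below m \<and> gcd a m = 1}. [:- x, 1:])
      = (\<Prod>a | a \<in> odd_below m \<and> gcd a m = 1. cos_factor m a)"
    by (rule prod_linear_factors_cos) auto
  finally show ?thesis .
qed

section \<open>Inclusion--exclusion over sets of primes\<close>

text \<open>Supersets of a proper subset \<open>U\<close> are balanced by parity of size; for
  \<open>U = S\<close> only \<open>A = S\<close> remains, with even codimension 0.\<close>

lemma card_supersets_even_odd_codim:
  fixes S U :: "'a set"
  assumes "finite S" "U \<subseteq> S"
  shows "card {A. A \<subseteq> S \<and> even (card S - card A) \<and> U \<subseteq> A}
    = card {A. A \<subseteq> S \<and> odd (card S - card A) \<and> U \<subseteq> A} + (if U = S then 1 else 0)"
proof (cases "U = S")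
  case True
  have "{A. A \<subseteq> S \<and> even (card S - card A) \<and> U \<subseteq> A} = {S}"
    "{A. A \<subseteq> S \<and> odd (card S - card A) \<and> U \<subseteq> A} = {}"
    using True by auto
  then show ?thesis using True by (simp only: if_P card.empty card_insert_if) simp
next
  case False
  then have *: "card {A. A \<subseteq> S \<and> U \<subseteq> A \<and> even (card A)} = card {A. A \<subseteq> S \<and> U \<subseteq> A \<and> odd (card A)}"
    using assms by (intro card_subsupersets_even_odd) auto
  \<comment> \<open>This excludes truncated subtraction, so the parity of
    \<open>card S - card A\<close> follows from those of the two sizes.\<close>
  have le: "\<not> card S < card A" if "A \<subseteq> S" for A
    using card_mono[OF assms(1) that] by simp
  show ?thesis
  proof (cases "even (card S)")
    case True
    then have "{A. A \<subseteq> S \<and> even (card S - card A) \<and> U \<subseteq> A} = {A. A \<subseteq> S \<and> U \<subseteq> A \<and> even (card A)}"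
      "{A. A \<subseteq> S \<and> odd (card S - card A) \<and> U \<subseteq> A} = {A. A \<subseteq> S \<and> U \<subseteq> A \<and> odd (card A)}"
      using le by (auto simp: even_diff_nat)
    then show ?thesis using * False by simp
  next
    case odd: False
    then have "{A. A \<subseteq> S \<and> even (card S - card A) \<and> U \<subseteq> A} = {A. A \<subseteq> S \<and> U \<subseteq> A \<and> odd (card A)}"
      "{A. A \<subseteq> S \<and> odd (card S - card A) \<and> U \<subseteq> A} = {A. A \<subseteq> S \<and> U \<subseteq> A \<and> even (card A)}"
      using le by (auto simp: even_diff_nat)
    then show ?thesis using * False by simp
  qed
qed

lemma prod_prod_filter_swap:
  fixes f :: "'a \<Rightarrow> 'c::comm_monoid_mult"
  assumes "finite I" "finite J"
  shows "(\<Prod>i\<in>I. \<Prod>j | j \<in> J \<and> P i j. f j) = (\<Prod>j\<in>J. f j ^ card {i \<in> I. P i j})"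
proof -
  have "(\<Prod>i\<in>I. \<Prod>j | j \<in> J \<and> P i j. f j) = (\<Prod>j\<in>J. \<Prod>i | i \<in> I \<and> P i j. f j)"
    by (rule prod.swap_restrict[OF assms])
  then show ?thesis by simp
qed

lemma prod_distinct_primes_dvd:
  fixes p :: "'a \<Rightarrow> nat"
  assumes "finite S" "inj_on p S" "\<And>j. j \<in> S \<Longrightarrow> prime (p j)" "\<And>j. j \<in> S \<Longrightarrow> p j dvd a"
  shows "(\<Prod>j\<in>S. p j) dvd a"
  using assms
proof (induction S rule: finite_induct)
  case (insert i S)
  have "algebraic_semidom_class.coprime (p i) (\<Prod>j\<in>S. p j)"
  proof (rule prod_coprime_right)
    fix j assume "j \<in> S"
    then have "p i \<noteq> p j" using insert.hyps insert.prems(1) by auto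
    then show "algebraic_semidom_class.coprime (p i) (p j)"
      using \<open>j \<in> S\<close> insert.prems(2) by (intro primes_coprime) auto
  qed
  then show ?case using insert by (simp add: divides_mult)
qed simp

text \<open>Over the reals both sides are products of powers of the same
  \<open>cos_factor m a\<close>, so it suffices to compare exponents for each \<open>a\<close>;
  these count subsets \<open>A\<close>.\<close>

lemma C_poly_mult_prod_t_hat:
  fixes p e :: "nat \<Rightarrow> nat" and n :: "nat set \<Rightarrow> nat"
  assumes S: "finite S" and p: "\<And>j. j \<in> S \<Longrightarrow> prime (p j) \<and> odd (p j)" and "inj_on p S"
    and e: "\<And>j. j \<in> S \<Longrightarrow> e j \<ge> 1"
    and m: "m = 2 ^ l * (\<Prod>j\<in>S. p j ^ e j)"
    and n: "\<And>A. A \<subseteq> S \<Longrightarrow> n A = 2 ^ l * (\<Prod>j\<in>S. p j ^ (e j - 1)) * (\<Prod>j\<in>A. p j)"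
  shows "C_poly (2 * m) * (\<Prod>A | A \<subseteq> S \<and> odd (card S - card A). t_hat (n A))
    = (\<Prod>A | A \<subseteq> S \<and> even (card S - card A). t_hat (n A))"
proof -
  let ?R = "map_poly of_rat :: rat poly \<Rightarrow> real poly"
  let ?L = "cos_factor m"
  \<comment> \<open>The factor of \<open>a\<close> occurs in \<open>t_hat (n A)\<close> iff all
    primes outside \<open>A\<close> divide \<open>a\<close>, that is, iff
    \<open>U a \<subseteq> A\<close>.\<close>
  define U where "U a = {j \<in> S. \<not> p j dvd a}" for a
  have "m \<ge> 1" unfolding m using p prime_gt_0_nat by (force intro!: prod_pos simp: Suc_le_eq)
  have dvd_iff: "(\<Prod>j\<in>S - A. p j) dvd a \<longleftrightarrow> U a \<subseteq> A" for A a
  proof -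
    have "(\<Prod>j\<in>S - A. p j) dvd a \<longleftrightarrow> (\<forall>j\<in>S - A. p j dvd a)"
    proof
      assume "(\<Prod>j\<in>S - A. p j) dvd a"
      then show "\<forall>j\<in>S - A. p j dvd a" using S by (meson dvd_prodI dvd_trans finite_Diff)
    next
      assume "\<forall>j\<in>S - A. p j dvd a"
      then show "(\<Prod>j\<in>S - A. p j) dvd a"
        using p \<open>inj_on p S\<close> S
        by (intro prod_distinct_primes_dvd) (auto intro: inj_on_subset)
    qed
    then show ?thesis unfolding U_def by auto
  qed
  have n_mult: "n A * (\<Prod>j\<in>S - A. p j) = m" if "A \<subseteq> S" for A
  proof -
    have "(\<Prod>j\<in>A. p j) * (\<Prod>j\<in>S - A. p j) = (\<Prod>j\<in>S. p j)"
      using prod.subset_diff[OF that S, of p] by (simp add: mult.commute)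
    then have "n A * (\<Prod>j\<in>S - A. p j) = 2 ^ l * (\<Prod>j\<in>S. p j ^ (e j - 1) * p j)"
      unfolding n[OF that] prod.distrib by (simp add: mult.assoc)
    also have "(\<Prod>j\<in>S. p j ^ (e j - 1) * p j) = (\<Prod>j\<in>S. p j ^ e j)"
    proof (rule prod.cong[OF refl])
      fix j assume "j \<in> S"
      then show "p j ^ (e j - 1) * p j = p j ^ e j" using e[of j] by (simp add: power_eq_if)
    qed
    finally show ?thesis unfolding m .
  qed
  have t: "?R (t_hat (n A)) = (\<Prod>a | a \<in> odd_below m \<and> U a \<subseteq> A. ?L a)" if "A \<subseteq> S" for A
  proof -
    have "odd (\<Prod>j\<in>S - A. p j)" using p S by (subst even_prod_iff) auto
    then show ?thesis
      using t_hat_eq_prod_cos_factor_multiples[OF n_mult[OF that]] \<open>m \<ge> 1\<close> dvd_iff by simp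
  qed
  have prod_t: "(\<Prod>A | A \<subseteq> S \<and> Q A. ?R (t_hat (n A)))
      = (\<Prod>a\<in>odd_below m. ?L a ^ card {A. A \<subseteq> S \<and> Q A \<and> U a \<subseteq> A})" for Q
  proof -
    have "(\<Prod>A | A \<subseteq> S \<and> Q A. ?R (t_hat (n A)))
        = (\<Prod>A | A \<subseteq> S \<and> Q A. \<Prod>a | a \<in> odd_below m \<and> U a \<subseteq> A. ?L a)"
      using t by (intro prod.cong) auto
    also have "\<dots> = (\<Prod>a\<in>odd_below m. ?L a ^ card {A \<in> {A. A \<subseteq> S \<and> Q A}. U a \<subseteq> A})"
      using S by (intro prod_prod_filter_swap) auto
    finally show ?thesis by (simp add: conj_assoc)
  qed
  \<comment> \<open>A common prime factor of \<open>a\<close> and \<open>m\<close> cannot be 2, as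
    \<open>a\<close> is odd, so it is some \<open>p j\<close>.\<close>
  have gcd_iff: "gcd a m = 1 \<longleftrightarrow> U a = S" if "a \<in> odd_below m" for a
  proof
    assume "gcd a m = 1"
    have "\<not> p j dvd a" if "j \<in> S" for j
    proof
      assume "p j dvd a"
      moreover have "p j dvd m"
        unfolding m using that S e[OF that] by (intro dvd_mult dvd_trans[OF _ dvd_prodI]) (auto intro!: dvd_power)
      ultimately have "p j dvd 1" using \<open>gcd a m = 1\<close> by (metis gcd_greatest)
      then show False using p[OF that] by simp
    qed
    then show "U a = S" unfolding U_def by auto
  next
    assume "U a = S"
    show "gcd a m = 1"
    proof (rule ccontr)
      assume "gcd a m \<noteq> 1"
      then obtain q where q: "prime q" "q dvd a" "q dvd m"
        using prime_factor_nat[of "gcd a m"] by auto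
      then consider "q dvd 2 ^ l" | j where "j \<in> S" "q dvd p j ^ e j"
        unfolding m using S by (auto simp: prime_dvd_mult_iff prime_dvd_prod_iff)
      then show False
      proof cases
        case 1
        then have "q dvd 2" using q(1) prime_dvd_power by blast
        then have "q = 2" using q(1) primes_dvd_imp_eq two_is_prime_nat by blast
        then show False using q(2) that by (simp add: odd_below_def)
      next
        case 2
        then have "q = p j" using q(1) p[OF 2(1)] prime_dvd_power primes_dvd_imp_eq by blast
        then show False using q(2) 2(1) \<open>U a = S\<close> unfolding U_def by auto
      qed
    qed
  qed
  have "?R (C_poly (2 * m)) = (\<Prod>a\<in>odd_below m. ?L a ^ (if U a = S then 1 else 0))"
    unfolding C_poly_eq_prod_cos_factor[OF \<open>m \<ge> 1\<close>] using gcd_iff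
    by (intro prod.mono_neutral_cong_left) auto
  then have "?R (C_poly (2 * m) * (\<Prod>A | A \<subseteq> S \<and> odd (card S - card A). t_hat (n A)))
      = (\<Prod>a\<in>odd_below m. ?L a ^ (card {A. A \<subseteq> S \<and> odd (card S - card A) \<and> U a \<subseteq> A}
          + (if U a = S then 1 else 0)))"
    unfolding of_rat_poly_hom.hom_mult of_rat_poly_hom.hom_prod prod_t power_add prod.distrib
    by (simp only: mult.commute)
  also have "\<dots> = (\<Prod>a\<in>odd_below m. ?L a ^ card {A. A \<subseteq> S \<and> even (card S - card A) \<and> U a \<subseteq> A})"
    using card_supersets_even_odd_codim[OF S] unfolding U_def by (intro prod.cong) simp_all
  also have "\<dots> = ?R (\<Prod>A | A \<subseteq> S \<and> even (card S - card A). t_hat (n A))"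
    unfolding of_rat_poly_hom.hom_prod prod_t ..
  finally show ?thesis by simp
qed

theorem mainTheorem7:
  fixes m k N :: nat and p e :: "nat \<Rightarrow> nat" and n :: "nat set \<Rightarrow> nat"
  assumes "m \<ge> 1"
    and "2 * m = 2 ^ k * (\<Prod>j\<in>{1..N}. p j ^ e j)"
    and "\<And>j. j \<in> {1..N} \<Longrightarrow> prime (p j) \<and> odd (p j)"
    and "inj_on p {1..N}"
    and "\<And>j. j \<in> {1..N} \<Longrightarrow> e j \<ge> 1"
    and "\<And>A. A \<subseteq> {1..N} \<Longrightarrow>
           n A = 2 ^ (k - 1) * (\<Prod>j\<in>{1..N}. p j ^ (e j - 1)) * (\<Prod>j\<in>A. p j)"
  shows "to_fract (C_poly (2 * m)) =
           (\<Prod>A | A \<subseteq> {1..N} \<and> even (N - card A). to_fract (t_hat (n A))) /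
           (\<Prod>A | A \<subseteq> {1..N} \<and> odd (N - card A). to_fract (t_hat (n A)))"
proof -
  have "odd (\<Prod>j\<in>{1..N}. p j ^ e j)" using assms(3) by (subst even_prod_iff) auto
  \<comment> \<open>The left side \<open>2 * m\<close> is even and the product odd; hence
    \<open>k - 1\<close> is a true difference and \<open>m\<close> has the form needed.\<close>
  then have "k \<noteq> 0" using assms(2) by (metis dvd_triv_left mult_1 power_0)
  then have m: "m = 2 ^ (k - 1) * (\<Prod>j\<in>{1..N}. p j ^ e j)"
    using assms(2) by (simp add: power_eq_if)
  have eq: "C_poly (2 * m) * (\<Prod>A | A \<subseteq> {1..N} \<and> odd (N - card A). t_hat (n A))
      = (\<Prod>A | A \<subseteq> {1..N} \<and> even (N - card A). t_hat (n A))"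
    using C_poly_mult_prod_t_hat[of "{1..N}" p e m "k - 1" n] assms m by simp
  have "t_hat (n A) \<noteq> 0" if "A \<subseteq> {1..N}" for A
  proof -
    have "n A > 0"
      unfolding assms(6)[OF that] using that assms(3) prime_gt_0_nat
      by (intro mult_pos_pos prod_pos) auto
    then show ?thesis using degree_t_hat[of "n A"] by auto
  qed
  then have "(\<Prod>A | A \<subseteq> {1..N} \<and> odd (N - card A). to_fract (t_hat (n A))) \<noteq> 0"
    by auto
  moreover have "to_fract (C_poly (2 * m)) * (\<Prod>A | A \<subseteq> {1..N} \<and> odd (N - card A). to_fract (t_hat (n A)))
      = (\<Prod>A | A \<subseteq> {1..N} \<and> even (N - card A). to_fract (t_hat (n A)))"
    using arg_cong[OF eq, of to_fract] by (simp only: to_fract_hom.hom_mult to_fract_hom.hom_prod)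
  ultimately show ?thesis by (simp add: eq_divide_eq)
qed

end
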